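(* Let $Z$ be a central ideal of a Leibniz algebra $L$ over a field $\mathbb{F}$. The sequence \[\mathcal{H}^2(L/Z,\mathbb{F})\xrightarrow{\mathrm{Inf}}\mathcal{H}^2(L,\mathbb{F})\xrightarrow{\delta}L/L'\otimes Z\oplus Z\otimes L/L'\] is exact, where the last term is identified with $\mathrm{Bil}(L/L'\times Z,\mathbb{F})\oplus\mathrm{Bil}(Z\times L/L',\mathbb{F})$, in which $\delta$ takes its values.
   Context: A (left) Leibniz algebra over a field $\mathbb{F}$ is an $\mathbb{F}$-vector space with a bilinear multiplication satisfying $x(yz)=(xy)z+y(xz)$. $L'$ is the span of all products in $L$; $Z(L)=\{z: zx=xz=0\ \forall x\in L\}$; a central ideal is an ideal contained in $Z(L)$. $\mathrm{Bil}(U\times V,\mathbb{F})$ is the space of bilinear forms $U\times V\to\mathbb{F}$. $\mathcal{H}^2(B,\mathbb{F})=\mathcal{Z}^2(B,\mathbb{F})/\mathcal{B}^2(B,\mathbb{F})$, where $\mathcal{Z}^2(B,\mathbb{F})$ is the space of bilinear forms $f:B\times B\to\mathbb{F}$ with $f(x,yz)=f(xy,z)+f(y,xz)$, and $\mathcal{B}^2(B,\mathbb{F})$ is the space of those of the form $f(x,y)=-\varepsilon(xy)$ with $\varepsilon:B\to\mathbb{F}$ linear. Maps: $\mathrm{Inf}(f+\mathcal{B}^2(L/Z,\mathbb{F}))=f'+\mathcal{B}^2(L,\mathbb{F})$ with $f'(x,y)=f(x+Z,y+Z)$. $\delta(f'+\mathcal{B}^2(L,\mathbb{F}))=(f_1'',f_2'')$,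 where $f_1'':L/L'\times Z\to\mathbb{F}$ and $f_2'':Z\times L/L'\to\mathbb{F}$ are the (well-defined) bilinear forms $f_1''(x+L',z)=f'(x,z)$ and $f_2''(z,x+L')=f'(z,x)$ for $x\in L$, $z\in Z$. *)

theory Defs
  imports "HOL.Hull" "HOL-Algebra.Module" "HOL-Algebra.QuotRing" "HOL-Algebra.Chinese_Remainder"
begin

text \<open>
  Vector spaces are modules in the sense of \<^theory>\<open>HOL-Algebra.Module\<close> over a ring satisfying
  \<^locale>\<open>field\<close>.  The record type of modules extends the one of rings; its \<^const>\<open>monoid.mult\<close> component
  is not constrained by \<^locale>\<open>module\<close> and carries the product of a Leibniz algebra.  The component
  \<^const>\<open>one\<close> is never used.
\<close>

definition linear_maps ::
    "('a, 'r) ring_scheme \<Rightarrow> ('a, 'b, 'm) module_scheme \<Rightarrow> ('a, 'c, 'n) module_scheme \<Rightarrow> ('b \<Rightarrow> 'c) set"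
  where "linear_maps F M N =
    {h \<in> hom (add_monoid M) (add_monoid N).
      \<forall>a\<in>carrier F. \<forall>x\<in>carrier M. h (a \<odot>\<^bsub>M\<^esub> x) = a \<odot>\<^bsub>N\<^esub> h x}"

definition bilin ::
    "('a, 'r) ring_scheme \<Rightarrow> ('a, 'b, 'm) module_scheme \<Rightarrow> ('a, 'c, 'n) module_scheme \<Rightarrow>
      ('a, 'd, 'o) module_scheme \<Rightarrow> ('b \<Rightarrow> 'c \<Rightarrow> 'd) \<Rightarrow> bool"
  where "bilin F U V W b \<longleftrightarrow>
    (\<forall>u\<in>carrier U. (\<lambda>v. b u v) \<in> linear_maps F V W) \<and>
    (\<forall>v\<in>carrier V. (\<lambda>u. b u v) \<in> linear_maps F U W)"

text \<open>The ring \<open>F\<close> as a module over itself.\<close>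

definition scalars :: "('a, 'r) ring_scheme \<Rightarrow> ('a, 'a) module"
  where "scalars F = ring.extend (ring.truncate F) \<lparr>smult = (\<otimes>\<^bsub>F\<^esub>)\<rparr>"

text \<open>
  The library quotient \<open>M Quot N\<close> with scalar multiplication added.  The union over representatives
  (rather than the image of the coset) is needed for the scalar \<open>0\<close>.
\<close>

definition quot_module :: "('a, 'b, 'm) module_scheme \<Rightarrow> 'b set \<Rightarrow> ('a, 'b set) module"
  where "quot_module M N =
    ring.extend (M Quot N) \<lparr>smult = (\<lambda>a X. \<Union>x\<in>X. N +>\<^bsub>M\<^esub> (a \<odot>\<^bsub>M\<^esub> x))\<rparr>"

definition direct_sum ::
    "('a, 'b, 'm) module_scheme \<Rightarrow> ('a, 'c, 'n) module_scheme \<Rightarrow> ('a, 'b \<times> 'c) module"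
  where "direct_sum M N =
    ring.extend (RDirProd M N) \<lparr>smult = (\<lambda>a (x, y). (a \<odot>\<^bsub>M\<^esub> x, a \<odot>\<^bsub>N\<^esub> y))\<rparr>"

text \<open>
  Bilinear forms are functions on pairs that are \<^const>\<open>undefined\<close> outside of
  \<open>carrier U \<times> carrier V\<close>, so that equality of forms is equality of functions.
\<close>

definition Bil ::
    "('a, 'r) ring_scheme \<Rightarrow> ('a, 'b, 'm) module_scheme \<Rightarrow> ('a, 'c, 'n) module_scheme \<Rightarrow>
      ('a, 'b \<times> 'c \<Rightarrow> 'a) module"
  where "Bil F U V =
    \<lparr>carrier = {f \<in> extensional (carrier U \<times> carrier V). bilin F U V (scalars F) (curry f)},
     mult = undefined, one = undefined,
     zero = (\<lambda>p\<in>carrier U \<times> carrier V. \<zero>\<^bsub>F\<^esub>),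
     add = (\<lambda>f g. \<lambda>p\<in>carrier U \<times> carrier V. f p \<oplus>\<^bsub>F\<^esub> g p),
     smult = (\<lambda>a f. \<lambda>p\<in>carrier U \<times> carrier V. a \<otimes>\<^bsub>F\<^esub> f p)\<rparr>"

text \<open>Exactness at \<open>B\<close> of a sequence \<open>A \<rightarrow> B \<rightarrow> C\<close> of modules and linear maps.\<close>

definition exact_at ::
    "('a, 'r) ring_scheme \<Rightarrow> ('a, 'b, 'm) module_scheme \<Rightarrow> ('b \<Rightarrow> 'c) \<Rightarrow>
      ('a, 'c, 'n) module_scheme \<Rightarrow> ('c \<Rightarrow> 'd) \<Rightarrow> ('a, 'd, 'o) module_scheme \<Rightarrow> bool"
  where "exact_at F A f B g C \<longleftrightarrow>
    module F A \<and> module F B \<and> module F C \<and>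
    f \<in> linear_maps F A B \<and> g \<in> linear_maps F B C \<and>
    f ` carrier A = a_kernel B C g"

locale leibniz_algebra = module F L + field F
  for F :: "('a, 'r) ring_scheme" (structure) and L :: "('a, 'b, 'm) module_scheme" (structure) +
  assumes mult_bilin: "bilin F L L L (\<otimes>\<^bsub>L\<^esub>)"
    and leibniz: "\<lbrakk>x \<in> carrier L; y \<in> carrier L; z \<in> carrier L\<rbrakk> \<Longrightarrow>
      x \<otimes>\<^bsub>L\<^esub> (y \<otimes>\<^bsub>L\<^esub> z) = (x \<otimes>\<^bsub>L\<^esub> y) \<otimes>\<^bsub>L\<^esub> z \<oplus>\<^bsub>L\<^esub> y \<otimes>\<^bsub>L\<^esub> (x \<otimes>\<^bsub>L\<^esub> z)"

definition leibniz_ideal :: "'b set \<Rightarrow> ('a, 'r) ring_scheme \<Rightarrow> ('a, 'b, 'm) module_scheme \<Rightarrow> bool"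
  where "leibniz_ideal I F L \<longleftrightarrow>
    submodule I F L \<and> (\<forall>x\<in>carrier L. \<forall>i\<in>I. x \<otimes>\<^bsub>L\<^esub> i \<in> I \<and> i \<otimes>\<^bsub>L\<^esub> x \<in> I)"

definition leibniz_center :: "('a, 'b, 'm) module_scheme \<Rightarrow> 'b set"
  where "leibniz_center L =
    {z \<in> carrier L. \<forall>x\<in>carrier L. z \<otimes>\<^bsub>L\<^esub> x = \<zero>\<^bsub>L\<^esub> \<and> x \<otimes>\<^bsub>L\<^esub> z = \<zero>\<^bsub>L\<^esub>}"

definition central_ideal :: "'b set \<Rightarrow> ('a, 'r) ring_scheme \<Rightarrow> ('a, 'b, 'm) module_scheme \<Rightarrow> bool"
  where "central_ideal Z F L \<longleftrightarrow> leibniz_ideal Z F L \<and> Z \<subseteq> leibniz_center L"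

definition leibniz_derived :: "('a, 'r) ring_scheme \<Rightarrow> ('a, 'b, 'm) module_scheme \<Rightarrow> 'b set"
  where "leibniz_derived F L =
    (\<lambda>H. submodule H F L) hull {x \<otimes>\<^bsub>L\<^esub> y | x y. x \<in> carrier L \<and> y \<in> carrier L}"

definition cocycles2 ::
    "('a, 'r) ring_scheme \<Rightarrow> ('a, 'b, 'm) module_scheme \<Rightarrow> ('a, 'b \<times> 'b \<Rightarrow> 'a) module"
  where "cocycles2 F B = (Bil F B B)
    \<lparr>carrier := {f \<in> carrier (Bil F B B).
      \<forall>x\<in>carrier B. \<forall>y\<in>carrier B. \<forall>z\<in>carrier B.
        f (x, y \<otimes>\<^bsub>B\<^esub> z) = f (x \<otimes>\<^bsub>B\<^esub> y, z) \<oplus>\<^bsub>F\<^esub> f (y, x \<otimes>\<^bsub>B\<^esub> z)}\<rparr>"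

definition coboundaries2 ::
    "('a, 'r) ring_scheme \<Rightarrow> ('a, 'b, 'm) module_scheme \<Rightarrow> ('b \<times> 'b \<Rightarrow> 'a) set"
  where "coboundaries2 F B =
    {(\<lambda>(x, y)\<in>carrier B \<times> carrier B. \<ominus>\<^bsub>F\<^esub> e (x \<otimes>\<^bsub>B\<^esub> y)) | e. e \<in> linear_maps F B (scalars F)}"

definition cohomology2 ::
    "('a, 'r) ring_scheme \<Rightarrow> ('a, 'b, 'm) module_scheme \<Rightarrow> ('a, ('b \<times> 'b \<Rightarrow> 'a) set) module"
  where "cohomology2 F B = quot_module (cocycles2 F B) (coboundaries2 F B)"

definition cohomology_class ::
    "('a, 'r) ring_scheme \<Rightarrow> ('a, 'b, 'm) module_scheme \<Rightarrow> ('b \<times> 'b \<Rightarrow> 'a) \<Rightarrow> ('b \<times> 'b \<Rightarrow> 'a) set"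
  where "cohomology_class F B f = coboundaries2 F B +>\<^bsub>cocycles2 F B\<^esub> f"

text \<open>
  A map induced on cosets is obtained, as in the library, by applying \<^const>\<open>the_elem\<close> to the set
  of all values at representatives.  The facts \<open>inflation_class\<close>, \<open>delta_apply\<close> and \<open>delta_class\<close>
  below show that the result does not depend on the representative.
\<close>

definition inflate ::
    "('a, 'b, 'm) module_scheme \<Rightarrow> 'b set \<Rightarrow> ('b set \<times> 'b set \<Rightarrow> 'a) \<Rightarrow> 'b \<times> 'b \<Rightarrow> 'a"
  where "inflate L Z f =
    (\<lambda>(x, y)\<in>carrier L \<times> carrier L. f (Z +>\<^bsub>L\<^esub> x, Z +>\<^bsub>L\<^esub> y))"

definition inflation ::
    "('a, 'r) ring_scheme \<Rightarrow> ('a, 'b, 'm) module_scheme \<Rightarrow> 'b set \<Rightarrow>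
      ('b set \<times> 'b set \<Rightarrow> 'a) set \<Rightarrow> ('b \<times> 'b \<Rightarrow> 'a) set"
  where "inflation F L Z c = the_elem ((\<lambda>f. cohomology_class F L (inflate L Z f)) ` c)"

definition delta1 ::
    "('a, 'r) ring_scheme \<Rightarrow> ('a, 'b, 'm) module_scheme \<Rightarrow> 'b set \<Rightarrow>
      ('b \<times> 'b \<Rightarrow> 'a) \<Rightarrow> 'b set \<times> 'b \<Rightarrow> 'a"
  where "delta1 F L Z f =
    (\<lambda>(X, z)\<in>carrier (quot_module L (leibniz_derived F L)) \<times> Z. the_elem ((\<lambda>x. f (x, z)) ` X))"

definition delta2 ::
    "('a, 'r) ring_scheme \<Rightarrow> ('a, 'b, 'm) module_scheme \<Rightarrow> 'b set \<Rightarrow>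
      ('b \<times> 'b \<Rightarrow> 'a) \<Rightarrow> 'b \<times> 'b set \<Rightarrow> 'a"
  where "delta2 F L Z f =
    (\<lambda>(z, X)\<in>Z \<times> carrier (quot_module L (leibniz_derived F L)). the_elem ((\<lambda>x. f (z, x)) ` X))"

definition delta ::
    "('a, 'r) ring_scheme \<Rightarrow> ('a, 'b, 'm) module_scheme \<Rightarrow> 'b set \<Rightarrow>
      ('b \<times> 'b \<Rightarrow> 'a) set \<Rightarrow> ('b set \<times> 'b \<Rightarrow> 'a) \<times> ('b \<times> 'b set \<Rightarrow> 'a)"
  where "delta F L Z c = the_elem ((\<lambda>f. (delta1 F L Z f, delta2 F L Z f)) ` c)"


subsection \<open>The induced maps are well defined\<close>

lemma scalars_simps [simp]:
  "carrier (scalars F) = carrier F" "add (scalars F) = add F" "zero (scalars F) = zero F"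
  "smult (scalars F) = monoid.mult F"
  by (simp_all add: scalars_def ring.defs)

lemma quot_module_simps:
  "carrier (quot_module M N) = a_rcosets\<^bsub>M\<^esub> N"
  "X \<otimes>\<^bsub>quot_module M N\<^esub> Y = rcoset_mult M N X Y"
  "zero (quot_module M N) = N"
  "X \<oplus>\<^bsub>quot_module M N\<^esub> Y = X <+>\<^bsub>M\<^esub> Y"
  "a \<odot>\<^bsub>quot_module M N\<^esub> X = (\<Union>x\<in>X. N +>\<^bsub>M\<^esub> (a \<odot>\<^bsub>M\<^esub> x))"
  by (simp_all add: quot_module_def FactRing_def ring.defs)

lemma carrier_quot_module: "carrier (quot_module M N) = (\<lambda>x. N +>\<^bsub>M\<^esub> x) ` carrier M"
  by (auto simp: quot_module_simps A_RCOSETS_defs a_r_coset_defs)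

lemma mem_a_r_coset: "x \<in> N +>\<^bsub>M\<^esub> y \<longleftrightarrow> (\<exists>n\<in>N. x = n \<oplus>\<^bsub>M\<^esub> y)"
  by (auto simp: a_r_coset_def')

lemma linear_mapsD:
  assumes "h \<in> linear_maps F M N"
  shows "\<And>x. x \<in> carrier M \<Longrightarrow> h x \<in> carrier N"
    and "\<And>x y. \<lbrakk>x \<in> carrier M; y \<in> carrier M\<rbrakk> \<Longrightarrow> h (x \<oplus>\<^bsub>M\<^esub> y) = h x \<oplus>\<^bsub>N\<^esub> h y"
    and "\<And>a x. \<lbrakk>a \<in> carrier F; x \<in> carrier M\<rbrakk> \<Longrightarrow> h (a \<odot>\<^bsub>M\<^esub> x) = a \<odot>\<^bsub>N\<^esub> h x"
  using assms by (auto simp: linear_maps_def hom_def)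

lemma linear_mapsI:
  assumes "\<And>x. x \<in> carrier M \<Longrightarrow> h x \<in> carrier N"
    "\<And>x y. \<lbrakk>x \<in> carrier M; y \<in> carrier M\<rbrakk> \<Longrightarrow> h (x \<oplus>\<^bsub>M\<^esub> y) = h x \<oplus>\<^bsub>N\<^esub> h y"
    "\<And>a x. \<lbrakk>a \<in> carrier F; x \<in> carrier M\<rbrakk> \<Longrightarrow> h (a \<odot>\<^bsub>M\<^esub> x) = a \<odot>\<^bsub>N\<^esub> h x"
  shows "h \<in> linear_maps F M N"
  using assms by (auto simp: linear_maps_def hom_def)

lemma Bil_simps:
  "f \<oplus>\<^bsub>Bil F U V\<^esub> g = (\<lambda>p\<in>carrier U \<times> carrier V. f p \<oplus>\<^bsub>F\<^esub> g p)"
  "\<zero>\<^bsub>Bil F U V\<^esub> = (\<lambda>p\<in>carrier U \<times> carrier V. \<zero>\<^bsub>F\<^esub>)"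
  "a \<odot>\<^bsub>Bil F U V\<^esub> f = (\<lambda>p\<in>carrier U \<times> carrier V. a \<otimes>\<^bsub>F\<^esub> f p)"
  by (simp_all add: Bil_def)

lemma BilD:
  assumes "f \<in> carrier (Bil F U V)"
  shows "f \<in> extensional (carrier U \<times> carrier V)"
    and "\<And>u v. \<lbrakk>u \<in> carrier U; v \<in> carrier V\<rbrakk> \<Longrightarrow> f (u, v) \<in> carrier F"
    and "\<And>u v w. \<lbrakk>u \<in> carrier U; v \<in> carrier V; w \<in> carrier V\<rbrakk> \<Longrightarrow>
      f (u, v \<oplus>\<^bsub>V\<^esub> w) = f (u, v) \<oplus>\<^bsub>F\<^esub> f (u, w)"
    and "\<And>u v w. \<lbrakk>u \<in> carrier U; v \<in> carrier U; w \<in> carrier V\<rbrakk> \<Longrightarrow>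
      f (u \<oplus>\<^bsub>U\<^esub> v, w) = f (u, w) \<oplus>\<^bsub>F\<^esub> f (v, w)"
    and "\<And>a u v. \<lbrakk>a \<in> carrier F; u \<in> carrier U; v \<in> carrier V\<rbrakk> \<Longrightarrow>
      f (u, a \<odot>\<^bsub>V\<^esub> v) = a \<otimes>\<^bsub>F\<^esub> f (u, v)"
    and "\<And>a u v. \<lbrakk>a \<in> carrier F; u \<in> carrier U; v \<in> carrier V\<rbrakk> \<Longrightarrow>
      f (a \<odot>\<^bsub>U\<^esub> u, v) = a \<otimes>\<^bsub>F\<^esub> f (u, v)"
  using assms by (auto simp: Bil_def bilin_def curry_def linear_maps_def hom_def)

lemma cocycles2_simps [simp]:
  "zero (cocycles2 F B) = zero (Bil F B B)"
  "add (cocycles2 F B) = add (Bil F B B)"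
  "smult (cocycles2 F B) = smult (Bil F B B)"
  by (simp_all add: cocycles2_def)

lemma cocycles2_iff:
  "f \<in> carrier (cocycles2 F B) \<longleftrightarrow> f \<in> carrier (Bil F B B) \<and>
    (\<forall>x\<in>carrier B. \<forall>y\<in>carrier B. \<forall>z\<in>carrier B.
      f (x, y \<otimes>\<^bsub>B\<^esub> z) = f (x \<otimes>\<^bsub>B\<^esub> y, z) \<oplus>\<^bsub>F\<^esub> f (y, x \<otimes>\<^bsub>B\<^esub> z))"
  by (simp add: cocycles2_def)

lemma cocycles2D:
  assumes "f \<in> carrier (cocycles2 F B)"
  shows "f \<in> carrier (Bil F B B)"
    and "\<And>x y z. \<lbrakk>x \<in> carrier B; y \<in> carrier B; z \<in> carrier B\<rbrakk> \<Longrightarrow>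
      f (x, y \<otimes>\<^bsub>B\<^esub> z) = f (x \<otimes>\<^bsub>B\<^esub> y, z) \<oplus>\<^bsub>F\<^esub> f (y, x \<otimes>\<^bsub>B\<^esub> z)"
  using assms unfolding cocycles2_iff by blast+

lemma coboundaries2E:
  assumes "b \<in> coboundaries2 F B"
  obtains e where "e \<in> linear_maps F B (scalars F)"
    "b = (\<lambda>(x, y)\<in>carrier B \<times> carrier B. \<ominus>\<^bsub>F\<^esub> e (x \<otimes>\<^bsub>B\<^esub> y))"
  using assms by (auto simp: coboundaries2_def)

lemma coboundaries2I:
  assumes "e \<in> linear_maps F B (scalars F)"
    "b = (\<lambda>(x, y)\<in>carrier B \<times> carrier B. \<ominus>\<^bsub>F\<^esub> e (x \<otimes>\<^bsub>B\<^esub> y))"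
  shows "b \<in> coboundaries2 F B"
  using assms by (auto simp: coboundaries2_def)

lemma the_elem_image_const: "\<lbrakk>A \<noteq> {}; \<And>x. x \<in> A \<Longrightarrow> f x = c\<rbrakk> \<Longrightarrow> the_elem (f ` A) = c"
  by (rule the_elem_image_unique) auto

context leibniz_algebra
begin

lemma mult_closed: "\<lbrakk>x \<in> carrier L; y \<in> carrier L\<rbrakk> \<Longrightarrow> x \<otimes>\<^bsub>L\<^esub> y \<in> carrier L"
  and mult_add_left: "\<lbrakk>x \<in> carrier L; y \<in> carrier L; z \<in> carrier L\<rbrakk> \<Longrightarrow>
    (x \<oplus>\<^bsub>L\<^esub> y) \<otimes>\<^bsub>L\<^esub> z = x \<otimes>\<^bsub>L\<^esub> z \<oplus>\<^bsub>L\<^esub> y \<otimes>\<^bsub>L\<^esub> z"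
  and mult_add_right: "\<lbrakk>x \<in> carrier L; y \<in> carrier L; z \<in> carrier L\<rbrakk> \<Longrightarrow>
    z \<otimes>\<^bsub>L\<^esub> (x \<oplus>\<^bsub>L\<^esub> y) = z \<otimes>\<^bsub>L\<^esub> x \<oplus>\<^bsub>L\<^esub> z \<otimes>\<^bsub>L\<^esub> y"
  using mult_bilin unfolding bilin_def linear_maps_def hom_def by auto

lemma coboundaries2_nonempty: "coboundaries2 F B \<noteq> {}"
  using coboundaries2I[OF linear_mapsI[of B "\<lambda>_. \<zero>" "scalars F" F] refl] by auto

lemma coboundaries2_values:
  "\<lbrakk>b \<in> coboundaries2 F L; x \<in> carrier L; y \<in> carrier L\<rbrakk> \<Longrightarrow> b (x, y) \<in> carrier F"
  by (elim coboundaries2E) (simp add: linear_mapsD(1)[where N = "scalars F", simplified] mult_closed)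

lemma coboundaries2_add:
  assumes "b \<in> coboundaries2 F L" "c \<in> coboundaries2 F L"
  shows "b \<oplus>\<^bsub>Bil F L L\<^esub> c \<in> coboundaries2 F L"
proof -
  obtain d e where d: "d \<in> linear_maps F L (scalars F)"
      "b = (\<lambda>(x, y)\<in>carrier L \<times> carrier L. \<ominus> d (x \<otimes>\<^bsub>L\<^esub> y))"
    and e: "e \<in> linear_maps F L (scalars F)"
      "c = (\<lambda>(x, y)\<in>carrier L \<times> carrier L. \<ominus> e (x \<otimes>\<^bsub>L\<^esub> y))"
    using assms by (elim coboundaries2E)
  note D = linear_mapsD[OF d(1), simplified] and E = linear_mapsD[OF e(1), simplified]
  show ?thesis
  proof (rule coboundaries2I)
    show "(\<lambda>x. d x \<oplus> e x) \<in> linear_maps F L (scalars F)"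
      by (rule linear_mapsI) (auto simp: D E R.a_ac R.r_distr)
    show "b \<oplus>\<^bsub>Bil F L L\<^esub> c = (\<lambda>(x, y)\<in>carrier L \<times> carrier L. \<ominus> (d (x \<otimes>\<^bsub>L\<^esub> y) \<oplus> e (x \<otimes>\<^bsub>L\<^esub> y)))"
      by (auto simp: Bil_simps d(2) e(2) D E mult_closed R.minus_add fun_eq_iff restrict_def)
  qed
qed

lemma coboundaries2_uminus:
  assumes "b \<in> coboundaries2 F L"
  shows "(\<lambda>p\<in>carrier L \<times> carrier L. \<ominus> b p) \<in> coboundaries2 F L"
proof -
  obtain e where e: "e \<in> linear_maps F L (scalars F)"
      "b = (\<lambda>(x, y)\<in>carrier L \<times> carrier L. \<ominus> e (x \<otimes>\<^bsub>L\<^esub> y))"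
    using assms by (elim coboundaries2E)
  note E = linear_mapsD[OF e(1), simplified]
  show ?thesis
  proof (rule coboundaries2I)
    show "(\<lambda>x. \<ominus> e x) \<in> linear_maps F L (scalars F)"
      by (rule linear_mapsI) (auto simp: E R.minus_add R.r_minus)
    show "(\<lambda>p\<in>carrier L \<times> carrier L. \<ominus> b p) =
        (\<lambda>(x, y)\<in>carrier L \<times> carrier L. \<ominus> (\<ominus> e (x \<otimes>\<^bsub>L\<^esub> y)))"
      by (auto simp: e(2) fun_eq_iff restrict_def)
  qed
qed

lemma cohomology_class_add_coboundary:
  assumes b: "b \<in> coboundaries2 F L"
    and f: "\<And>x y. \<lbrakk>x \<in> carrier L; y \<in> carrier L\<rbrakk> \<Longrightarrow> f (x, y) \<in> carrier F"
  shows "cohomology_class F L (b \<oplus>\<^bsub>Bil F L L\<^esub> f) = cohomology_class F L f"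
proof (intro equalityI subsetI)
  fix h assume "h \<in> cohomology_class F L (b \<oplus>\<^bsub>Bil F L L\<^esub> f)"
  then obtain c where c: "c \<in> coboundaries2 F L" "h = c \<oplus>\<^bsub>Bil F L L\<^esub> (b \<oplus>\<^bsub>Bil F L L\<^esub> f)"
    by (auto simp: cohomology_class_def mem_a_r_coset)
  then have "h = (c \<oplus>\<^bsub>Bil F L L\<^esub> b) \<oplus>\<^bsub>Bil F L L\<^esub> f"
    using f coboundaries2_values[OF b] coboundaries2_values[OF c(1)]
    by (auto simp: Bil_simps R.a_assoc fun_eq_iff restrict_def)
  then show "h \<in> cohomology_class F L f"
    using coboundaries2_add[OF c(1) b] by (auto simp: cohomology_class_def mem_a_r_coset)
next
  let ?n = "\<lambda>p\<in>carrier L \<times> carrier L. \<ominus> b p"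
  fix h assume "h \<in> cohomology_class F L f"
  then obtain c where c: "c \<in> coboundaries2 F L" "h = c \<oplus>\<^bsub>Bil F L L\<^esub> f"
    by (auto simp: cohomology_class_def mem_a_r_coset)
  then have "h = (c \<oplus>\<^bsub>Bil F L L\<^esub> ?n) \<oplus>\<^bsub>Bil F L L\<^esub> (b \<oplus>\<^bsub>Bil F L L\<^esub> f)"
    using f coboundaries2_values[OF b] coboundaries2_values[OF c(1)]
    by (auto simp: Bil_simps R.a_assoc R.r_neg1 fun_eq_iff restrict_def)
  then show "h \<in> cohomology_class F L (b \<oplus>\<^bsub>Bil F L L\<^esub> f)"
    using coboundaries2_add[OF c(1) coboundaries2_uminus[OF b]]
    by (auto simp: cohomology_class_def mem_a_r_coset)
qed

context
  fixes Z
  assumes Z: "central_ideal Z F L"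
begin

lemma Z_submodule: "submodule Z F L"
  using Z by (simp add: central_ideal_def leibniz_ideal_def)

lemma Z_carrier: "z \<in> Z \<Longrightarrow> z \<in> carrier L"
  using submoduleE(1)[OF Z_submodule] by auto

lemma Z_mult: "\<lbrakk>z \<in> Z; x \<in> carrier L\<rbrakk> \<Longrightarrow> z \<otimes>\<^bsub>L\<^esub> x = \<zero>\<^bsub>L\<^esub>"
  "\<lbrakk>z \<in> Z; x \<in> carrier L\<rbrakk> \<Longrightarrow> x \<otimes>\<^bsub>L\<^esub> z = \<zero>\<^bsub>L\<^esub>"
  using Z by (auto simp: central_ideal_def leibniz_center_def)

lemma quotient_add:
  assumes "x \<in> carrier L" "y \<in> carrier L"
  shows "(Z +>\<^bsub>L\<^esub> x) \<oplus>\<^bsub>quot_module L Z\<^esub> (Z +>\<^bsub>L\<^esub> y) = Z +>\<^bsub>L\<^esub> (x \<oplus>\<^bsub>L\<^esub> y)"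
proof -
  have "abelian_subgroup Z L"
    using Z_submodule
    by (simp add: M.abelian_group_axioms abelian_subgroupI3 additive_subgroup_def submodule_def)
  then show ?thesis
    using assms by (simp add: quot_module_simps abelian_subgroup.a_rcos_sum)
qed

lemma mem_own_coset: "x \<in> carrier L \<Longrightarrow> x \<in> Z +>\<^bsub>L\<^esub> x"
  using subgroup.one_closed[of Z "add_monoid L"] Z_submodule
  by (force simp: submodule_def mem_a_r_coset)

lemma quotient_smult:
  assumes "a \<in> carrier F" "x \<in> carrier L"
  shows "a \<odot>\<^bsub>quot_module L Z\<^esub> (Z +>\<^bsub>L\<^esub> x) = Z +>\<^bsub>L\<^esub> (a \<odot>\<^bsub>L\<^esub> x)"
proof -
  have "Z +>\<^bsub>L\<^esub> (a \<odot>\<^bsub>L\<^esub> y) = Z +>\<^bsub>L\<^esub> (a \<odot>\<^bsub>L\<^esub> x)" if y: "y \<in> Z +>\<^bsub>L\<^esub> x" for y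
  proof -
    have "a \<odot>\<^bsub>L\<^esub> y \<in> Z +>\<^bsub>L\<^esub> (a \<odot>\<^bsub>L\<^esub> x)"
      using y assms submoduleE(4)[OF Z_submodule] by (auto simp: mem_a_r_coset smult_r_distr Z_carrier)
    then show ?thesis
      using M.a_repr_independence[of "a \<odot>\<^bsub>L\<^esub> y" Z "a \<odot>\<^bsub>L\<^esub> x"] assms Z_submodule
      by (simp add: submodule_def)
  qed
  then have "(\<Union>y\<in>Z +>\<^bsub>L\<^esub> x. Z +>\<^bsub>L\<^esub> (a \<odot>\<^bsub>L\<^esub> y)) = Z +>\<^bsub>L\<^esub> (a \<odot>\<^bsub>L\<^esub> x)"
    using mem_own_coset[OF assms(2)] by blast
  then show ?thesis
    by (simp add: quot_module_simps)
qed

lemma quotient_mult: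
  assumes "x \<in> carrier L" "y \<in> carrier L"
  shows "(Z +>\<^bsub>L\<^esub> x) \<otimes>\<^bsub>quot_module L Z\<^esub> (Z +>\<^bsub>L\<^esub> y) = Z +>\<^bsub>L\<^esub> (x \<otimes>\<^bsub>L\<^esub> y)"
proof -
  have "x' \<otimes>\<^bsub>L\<^esub> y' = x \<otimes>\<^bsub>L\<^esub> y" if "x' \<in> Z +>\<^bsub>L\<^esub> x" "y' \<in> Z +>\<^bsub>L\<^esub> y" for x' y'
    using that assms
    by (auto simp: mem_a_r_coset mult_add_left mult_add_right Z_mult Z_carrier mult_closed)
  then have "rcoset_mult L Z (Z +>\<^bsub>L\<^esub> x) (Z +>\<^bsub>L\<^esub> y) =
      (\<Union>a\<in>Z +>\<^bsub>L\<^esub> x. \<Union>b\<in>Z +>\<^bsub>L\<^esub> y. Z +>\<^bsub>L\<^esub> (x \<otimes>\<^bsub>L\<^esub> y))"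
    unfolding rcoset_mult_def by (intro SUP_cong) auto
  then show ?thesis
    using assms[THEN mem_own_coset] by (auto simp: quot_module_simps)
qed

lemma inflate_coboundary:
  assumes "b \<in> coboundaries2 F (quot_module L Z)"
  shows "inflate L Z b \<in> coboundaries2 F L"
proof -
  obtain e where e: "e \<in> linear_maps F (quot_module L Z) (scalars F)"
      "b = (\<lambda>(x, y)\<in>carrier (quot_module L Z) \<times> carrier (quot_module L Z).
        \<ominus> e (x \<otimes>\<^bsub>quot_module L Z\<^esub> y))"
    using assms by (elim coboundaries2E)
  note E = linear_mapsD[OF e(1), simplified]
  show ?thesis
  proof (rule coboundaries2I)
    show "(\<lambda>x. e (Z +>\<^bsub>L\<^esub> x)) \<in> linear_maps F L (scalars F)"
      by (rule linear_mapsI)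
        (auto simp: E carrier_quot_module simp flip: quotient_add quotient_smult)
    show "inflate L Z b = (\<lambda>(x, y)\<in>carrier L \<times> carrier L. \<ominus> e (Z +>\<^bsub>L\<^esub> (x \<otimes>\<^bsub>L\<^esub> y)))"
      by (auto simp: inflate_def e(2) carrier_quot_module quotient_mult fun_eq_iff restrict_def)
  qed
qed

lemma inflation_class:
  assumes f: "f \<in> carrier (cocycles2 F (quot_module L Z))"
  shows "inflation F L Z (cohomology_class F (quot_module L Z) f) =
    cohomology_class F L (inflate L Z f)"
  unfolding inflation_def
proof (rule the_elem_image_const)
  show "cohomology_class F (quot_module L Z) f \<noteq> {}"
    using coboundaries2_nonempty by (auto simp: cohomology_class_def a_r_coset_def')
next
  fix h assume "h \<in> cohomology_class F (quot_module L Z) f"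
  then obtain b where b: "b \<in> coboundaries2 F (quot_module L Z)"
      "h = b \<oplus>\<^bsub>Bil F (quot_module L Z) (quot_module L Z)\<^esub> f"
    by (auto simp: cohomology_class_def mem_a_r_coset)
  have "inflate L Z h = inflate L Z b \<oplus>\<^bsub>Bil F L L\<^esub> inflate L Z f"
    by (auto simp: b(2) inflate_def Bil_simps carrier_quot_module fun_eq_iff restrict_def)
  moreover have "inflate L Z f (x, y) \<in> carrier F" if "x \<in> carrier L" "y \<in> carrier L" for x y
    using that BilD(2)[OF cocycles2D(1)[OF f]] by (simp add: inflate_def carrier_quot_module)
  ultimately show "cohomology_class F L (inflate L Z h) = cohomology_class F L (inflate L Z f)"
    using cohomology_class_add_coboundary[OF inflate_coboundary[OF b(1)]] by simp
qed

lemma derived_carrier: "x \<in> leibniz_derived F L \<Longrightarrow> x \<in> carrier L"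
  using hull_minimal[of "{x \<otimes>\<^bsub>L\<^esub> y | x y. x \<in> carrier L \<and> y \<in> carrier L}" "carrier L"
      "\<lambda>H. submodule H F L"] carrier_is_submodule mult_closed
  by (auto simp: leibniz_derived_def)

lemma cocycle_derived:
  assumes f: "f \<in> carrier (cocycles2 F L)" and x: "x \<in> leibniz_derived F L" and z: "z \<in> Z"
  shows "f (x, z) = \<zero>" "f (z, x) = \<zero>"
proof -
  let ?K = "{x \<in> carrier L. f (x, z) = \<zero> \<and> f (z, x) = \<zero>}"
  note B = BilD[OF cocycles2D(1)[OF f]] and C = cocycles2D(2)[OF f] and zL = Z_carrier[OF z]
  have 0: "f (\<zero>\<^bsub>L\<^esub>, y) = \<zero>" "f (y, \<zero>\<^bsub>L\<^esub>) = \<zero>" if "y \<in> carrier L" for y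
    using B(6)[of \<zero> "\<zero>\<^bsub>L\<^esub>" y] B(5)[of \<zero> y "\<zero>\<^bsub>L\<^esub>"] that B(2) by auto
  have "submodule ?K F L"
  proof (rule submoduleI)
    fix a assume a: "a \<in> ?K"
    have "\<ominus>\<^bsub>L\<^esub> a = (\<ominus> \<one>) \<odot>\<^bsub>L\<^esub> a"
      using a by (simp add: smult_l_minus)
    then show "\<ominus>\<^bsub>L\<^esub> a \<in> ?K"
      using a zL by (simp add: B)
  qed (use zL in \<open>auto simp: B 0\<close>)
  moreover have "{x \<otimes>\<^bsub>L\<^esub> y | x y. x \<in> carrier L \<and> y \<in> carrier L} \<subseteq> ?K"
  proof safe
    fix a b assume ab: "a \<in> carrier L" "b \<in> carrier L"
    then show "a \<otimes>\<^bsub>L\<^esub> b \<in> carrier L" by (rule mult_closed)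
    show "f (a \<otimes>\<^bsub>L\<^esub> b, z) = \<zero>"
      using C[of a b z] ab z zL B(2) by (simp add: Z_mult 0 mult_closed)
    show "f (z, a \<otimes>\<^bsub>L\<^esub> b) = \<zero>"
      using C[of z a b] ab z zL B(2) by (simp add: Z_mult 0 mult_closed)
  qed
  ultimately have "leibniz_derived F L \<subseteq> ?K"
    unfolding leibniz_derived_def by (intro hull_minimal)
  then show "f (x, z) = \<zero>" "f (z, x) = \<zero>"
    using x by auto
qed

lemma delta_apply:
  assumes f: "f \<in> carrier (cocycles2 F L)" and x: "x \<in> carrier L" and z: "z \<in> Z"
  shows "delta1 F L Z f (leibniz_derived F L +>\<^bsub>L\<^esub> x, z) = f (x, z)"
    and "delta2 F L Z f (z, leibniz_derived F L +>\<^bsub>L\<^esub> x) = f (z, x)"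
proof -
  let ?X = "leibniz_derived F L +>\<^bsub>L\<^esub> x"
  note B = BilD[OF cocycles2D(1)[OF f]]
  have "\<zero>\<^bsub>L\<^esub> \<otimes>\<^bsub>L\<^esub> \<zero>\<^bsub>L\<^esub> \<in> leibniz_derived F L"
    unfolding leibniz_derived_def by (rule hull_inc) auto
  then have "?X \<noteq> {}"
    by (auto simp: a_r_coset_def')
  moreover have "f (y, z) = f (x, z)" "f (z, y) = f (z, x)" if "y \<in> ?X" for y
    using that x Z_carrier[OF z] derived_carrier
    by (auto simp: mem_a_r_coset B cocycle_derived[OF f _ z])
  ultimately have "the_elem ((\<lambda>x. f (x, z)) ` ?X) = f (x, z)"
      "the_elem ((\<lambda>x. f (z, x)) ` ?X) = f (z, x)"
    by (auto intro!: the_elem_image_const)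
  then show "delta1 F L Z f (?X, z) = f (x, z)" "delta2 F L Z f (z, ?X) = f (z, x)"
    using x z by (auto simp: delta1_def delta2_def carrier_quot_module)
qed

lemma delta_class:
  assumes f: "f \<in> carrier (cocycles2 F L)"
  shows "delta F L Z (cohomology_class F L f) = (delta1 F L Z f, delta2 F L Z f)"
  unfolding delta_def
proof (rule the_elem_image_const)
  show "cohomology_class F L f \<noteq> {}"
    using coboundaries2_nonempty by (auto simp: cohomology_class_def a_r_coset_def')
next
  fix h assume "h \<in> cohomology_class F L f"
  then obtain b where b: "b \<in> coboundaries2 F L" "h = b \<oplus>\<^bsub>Bil F L L\<^esub> f"
    by (auto simp: cohomology_class_def mem_a_r_coset)
  obtain e where e: "e \<in> linear_maps F L (scalars F)"
      "b = (\<lambda>(x, y)\<in>carrier L \<times> carrier L. \<ominus> e (x \<otimes>\<^bsub>L\<^esub> y))"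
    using b(1) by (elim coboundaries2E)
  have "e \<zero>\<^bsub>L\<^esub> = \<zero>"
    using linear_mapsD(3)[OF e(1), of \<zero> "\<zero>\<^bsub>L\<^esub>"] linear_mapsD(1)[OF e(1), of "\<zero>\<^bsub>L\<^esub>"] by simp
  then have hf: "h (x, z) = f (x, z)" "h (z, x) = f (z, x)" if "x \<in> carrier L" "z \<in> Z" for x z
    using that Z_carrier[OF that(2)] BilD(2)[OF cocycles2D(1)[OF f]]
    by (auto simp: b(2) e(2) Bil_simps Z_mult)
  have X: "x \<in> carrier L"
    if "X \<in> carrier (quot_module L (leibniz_derived F L))" "x \<in> X" for x X
    using that derived_carrier by (auto simp: carrier_quot_module mem_a_r_coset)
  have "(\<lambda>x. h (x, z)) ` X = (\<lambda>x. f (x, z)) ` X" "(\<lambda>x. h (z, x)) ` X = (\<lambda>x. f (z, x)) ` X"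
    if "X \<in> carrier (quot_module L (leibniz_derived F L))" "z \<in> Z" for X z
    using that X hf by (auto intro!: image_cong)
  then show "(delta1 F L Z h, delta2 F L Z h) = (delta1 F L Z f, delta2 F L Z f)"
    by (auto simp: delta1_def delta2_def fun_eq_iff restrict_def)
qed

end

end

end

theory Submission
  imports Defs
begin

text \<open>
  A cocycle \<open>f\<close> on \<open>L\<close> satisfies \<open>\<delta> f = 0\<close> iff \<open>f (x, z) = f (z, x) = 0\<close> for all \<open>x \<in> L\<close>, \<open>z \<in> Z\<close>.
  By bilinearity this says that \<open>f\<close> depends only on the cosets of its arguments modulo \<open>Z\<close>, i.e. that
  \<open>f\<close> itself, not merely its class, is the inflation of a bilinear form on \<open>L/Z\<close>; that form inherits
  the cocycle identity.
\<close>

section \<open>Submodule criterion and spans\<close>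

lemma (in submodule) zero_mem: "\<zero>\<^bsub>M\<^esub> \<in> H"
  using one_closed by simp

text \<open>Additive inverses are multiples by the scalar \<open>\<ominus> \<one>\<close>, so
  closure under them follows from closure under scalars.\<close>

lemma (in module) submodule_if_closed:
  assumes "H \<subseteq> carrier M" "\<zero>\<^bsub>M\<^esub> \<in> H"
    and "\<And>x y. \<lbrakk>x \<in> H; y \<in> H\<rbrakk> \<Longrightarrow> x \<oplus>\<^bsub>M\<^esub> y \<in> H"
    and "\<And>a x. \<lbrakk>a \<in> carrier R; x \<in> H\<rbrakk> \<Longrightarrow> a \<odot>\<^bsub>M\<^esub> x \<in> H"
  shows "submodule H R M"
proof (rule submoduleI)
  fix x assume x: "x \<in> H"
  then have "\<ominus>\<^bsub>M\<^esub> x = (\<ominus> \<one>) \<odot>\<^bsub>M\<^esub> x"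
    using assms(1) by (auto simp: smult_l_minus)
  then show "\<ominus>\<^bsub>M\<^esub> x \<in> H"
    using assms(4) x by simp
qed (use assms in auto)

text \<open>The hull is an intersection of submodules, so the closure properties pass to it;
  \<open>carrier M\<close> is one of the submodules intersected, which bounds the hull.\<close>

lemma (in module) submodule_hull: "A \<subseteq> carrier M \<Longrightarrow> submodule ((\<lambda>H. submodule H R M) hull A) R M"
proof (rule submodule_if_closed)
  assume "A \<subseteq> carrier M"
  then show "(\<lambda>H. submodule H R M) hull A \<subseteq> carrier M"
    by (intro hull_minimal carrier_is_submodule)
qed (auto simp: hull_def submodule.smult_closed submoduleE(5) submodule.zero_mem)

subsection \<open>Quotient modules and direct sums\<close>

context module
begin

context
  fixes N
  assumes N: "submodule N R M"
begin

lemma coset_add: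
  assumes "x \<in> carrier M" "y \<in> carrier M"
  shows "(N +>\<^bsub>M\<^esub> x) \<oplus>\<^bsub>quot_module M N\<^esub> (N +>\<^bsub>M\<^esub> y) = N +>\<^bsub>M\<^esub> (x \<oplus>\<^bsub>M\<^esub> y)"
proof -
  have "abelian_subgroup N M"
    using N by (simp add: M.abelian_group_axioms abelian_subgroupI3 additive_subgroup_def submodule_def)
  then show ?thesis
    using assms by (simp add: quot_module_simps abelian_subgroup.a_rcos_sum)
qed

lemma coset_self: "x \<in> carrier M \<Longrightarrow> x \<in> N +>\<^bsub>M\<^esub> x"
  using subgroup.one_closed[of N "add_monoid M"] N
  by (force simp: submodule_def mem_a_r_coset)

lemma coset_eq: "\<lbrakk>y \<in> N +>\<^bsub>M\<^esub> x; x \<in> carrier M\<rbrakk> \<Longrightarrow> N +>\<^bsub>M\<^esub> y = N +>\<^bsub>M\<^esub> x"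
  using M.a_repr_independence[of y N x] N by (simp add: submodule_def)

text \<open>The scalar multiplication of \<open>quot_module\<close> is a union of cosets over all
  representatives. They all coincide, because \<open>a\<close> maps \<open>N\<close> into itself,
  and \<open>x\<close> is one of the representatives, so the union is their common value.\<close>

lemma coset_smult:
  assumes "a \<in> carrier R" "x \<in> carrier M"
  shows "a \<odot>\<^bsub>quot_module M N\<^esub> (N +>\<^bsub>M\<^esub> x) = N +>\<^bsub>M\<^esub> (a \<odot>\<^bsub>M\<^esub> x)"
proof -
  have "N +>\<^bsub>M\<^esub> (a \<odot>\<^bsub>M\<^esub> y) = N +>\<^bsub>M\<^esub> (a \<odot>\<^bsub>M\<^esub> x)" if "y \<in> N +>\<^bsub>M\<^esub> x" for y
    using that assms submoduleE(1,4)[OF N]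
    by (intro coset_eq) (auto simp: mem_a_r_coset smult_r_distr subset_iff)
  then have "(\<Union>y\<in>N +>\<^bsub>M\<^esub> x. N +>\<^bsub>M\<^esub> (a \<odot>\<^bsub>M\<^esub> y)) = N +>\<^bsub>M\<^esub> (a \<odot>\<^bsub>M\<^esub> x)"
    using coset_self[OF assms(2)] by blast
  then show ?thesis
    by (simp add: quot_module_simps)
qed

text \<open>Gives the zero of the quotient an explicit representative, so that the module laws can
  be computed on representatives.\<close>

lemma coset_zero: "\<zero>\<^bsub>quot_module M N\<^esub> = N +>\<^bsub>M\<^esub> \<zero>\<^bsub>M\<^esub>"
  using submoduleE(1)[OF N] by (simp add: quot_module_simps)

lemma coset_eq_zero: "x \<in> N \<Longrightarrow> N +>\<^bsub>M\<^esub> x = \<zero>\<^bsub>quot_module M N\<^esub>"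
  using submoduleE(1)[OF N] M.a_coset_join2[of x N] submodule.axioms(1)[OF N]
  by (simp add: quot_module_simps subset_iff)

lemma quot_module_module: "module R (quot_module M N)"
proof -
  have "abelian_group (quot_module M N)"
  proof (rule abelian_groupI)
    fix X assume "X \<in> carrier (quot_module M N)"
    then obtain x where "x \<in> carrier M" "X = N +>\<^bsub>M\<^esub> x"
      by (auto simp: carrier_quot_module)
    then show "\<exists>Y\<in>carrier (quot_module M N). Y \<oplus>\<^bsub>quot_module M N\<^esub> X = \<zero>\<^bsub>quot_module M N\<^esub>"
      by (intro bexI[of _ "N +>\<^bsub>M\<^esub> (\<ominus>\<^bsub>M\<^esub> x)"])
        (auto simp: carrier_quot_module coset_add coset_zero M.l_neg)
  \<comment> \<open>The deleted rule would fold the coset of zero back into \<open>N\<close>, a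
    shape to which \<open>coset_add\<close> does not apply.\<close>
  qed (unfold carrier_quot_module coset_zero, (elim imageE)?; simp add: coset_add M.a_ac del: M.a_coset_add_zero)+
  then show ?thesis
    by (rule moduleI[OF R.is_cring]; unfold carrier_quot_module, (elim imageE)?;
        simp add: coset_add coset_smult smult_l_distr smult_r_distr smult_assoc1)
qed

end

end

lemma direct_sum_simps:
  "carrier (direct_sum M N) = carrier M \<times> carrier N"
  "zero (direct_sum M N) = (zero M, zero N)"
  "p \<oplus>\<^bsub>direct_sum M N\<^esub> q = (fst p \<oplus>\<^bsub>M\<^esub> fst q, snd p \<oplus>\<^bsub>N\<^esub> snd q)"
  "a \<odot>\<^bsub>direct_sum M N\<^esub> p = (a \<odot>\<^bsub>M\<^esub> fst p, a \<odot>\<^bsub>N\<^esub> snd p)"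
  by (simp_all add: direct_sum_def RDirProd_def DirProd_def ring.defs monoid.defs case_prod_beta)

lemma direct_sum_module:
  assumes "module F M" "module F N"
  shows "module F (direct_sum M N)"
proof -
  interpret M: module F M by fact
  interpret N: module F N by fact
  show ?thesis
  proof (intro moduleI abelian_groupI)
    fix p assume "p \<in> carrier (direct_sum M N)"
    then show "\<exists>q\<in>carrier (direct_sum M N). q \<oplus>\<^bsub>direct_sum M N\<^esub> p = \<zero>\<^bsub>direct_sum M N\<^esub>"
      by (intro bexI[of _ "(\<ominus>\<^bsub>M\<^esub> fst p, \<ominus>\<^bsub>N\<^esub> snd p)"])
        (auto simp: direct_sum_simps M.M.l_neg N.M.l_neg)
  qed (auto simp: direct_sum_simps M.M.a_ac N.M.a_ac M.smult_l_distr M.smult_r_distr M.smult_assoc1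
      N.smult_l_distr N.smult_r_distr N.smult_assoc1 M.R.is_cring)
qed

subsection \<open>Modules of bilinear forms\<close>

lemma BilI:
  assumes "f \<in> extensional (carrier U \<times> carrier V)"
    and "\<And>u v. \<lbrakk>u \<in> carrier U; v \<in> carrier V\<rbrakk> \<Longrightarrow> f (u, v) \<in> carrier F"
    and "\<And>u v w. \<lbrakk>u \<in> carrier U; v \<in> carrier V; w \<in> carrier V\<rbrakk> \<Longrightarrow>
      f (u, v \<oplus>\<^bsub>V\<^esub> w) = f (u, v) \<oplus>\<^bsub>F\<^esub> f (u, w)"
    and "\<And>u v w. \<lbrakk>u \<in> carrier U; v \<in> carrier U; w \<in> carrier V\<rbrakk> \<Longrightarrow>
      f (u \<oplus>\<^bsub>U\<^esub> v, w) = f (u, w) \<oplus>\<^bsub>F\<^esub> f (v, w)"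
    and "\<And>a u v. \<lbrakk>a \<in> carrier F; u \<in> carrier U; v \<in> carrier V\<rbrakk> \<Longrightarrow>
      f (u, a \<odot>\<^bsub>V\<^esub> v) = a \<otimes>\<^bsub>F\<^esub> f (u, v)"
    and "\<And>a u v. \<lbrakk>a \<in> carrier F; u \<in> carrier U; v \<in> carrier V\<rbrakk> \<Longrightarrow>
      f (a \<odot>\<^bsub>U\<^esub> u, v) = a \<otimes>\<^bsub>F\<^esub> f (u, v)"
  shows "f \<in> carrier (Bil F U V)"
  using assms by (auto simp: Bil_def bilin_def curry_def linear_maps_def hom_def)

lemma Bil_module:
  assumes "module F U" "module F V"
  shows "module F (Bil F U V)"
proof -
  interpret U: module F U by fact
  interpret V: module F V by fact
  \<comment> \<open>The operations on forms return functions restricted to the product of the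
    carriers; getting \<open>g\<close> itself back relies on \<open>g\<close> being
    extensional.\<close>
  have ext: "(\<lambda>p\<in>carrier U \<times> carrier V. f p) = g"
    if "g \<in> carrier (Bil F U V)" "\<And>u v. \<lbrakk>u \<in> carrier U; v \<in> carrier V\<rbrakk> \<Longrightarrow> f (u, v) = g (u, v)" for f g
    using that BilD(1)[OF that(1)] by (auto simp: fun_eq_iff extensional_def)
  show ?thesis
  proof (intro moduleI abelian_groupI)
    fix f assume f: "f \<in> carrier (Bil F U V)"
    note B = BilD[OF f]
    have "(\<lambda>p\<in>carrier U \<times> carrier V. \<ominus>\<^bsub>F\<^esub> f p) \<in> carrier (Bil F U V)"
      by (rule BilI) (auto simp: B U.R.minus_add U.R.r_minus)
    then show "\<exists>g\<in>carrier (Bil F U V). g \<oplus>\<^bsub>Bil F U V\<^esub> f = \<zero>\<^bsub>Bil F U V\<^esub>"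
      by (rule bexI[rotated]) (auto simp: Bil_simps fun_eq_iff B U.R.l_neg)
    show "\<zero>\<^bsub>Bil F U V\<^esub> \<oplus>\<^bsub>Bil F U V\<^esub> f = f"
      unfolding Bil_simps by (rule ext[OF f]) (simp add: B)
    show "\<one>\<^bsub>F\<^esub> \<odot>\<^bsub>Bil F U V\<^esub> f = f"
      unfolding Bil_simps by (rule ext[OF f]) (simp add: B)
  next
    fix f g assume "f \<in> carrier (Bil F U V)" "g \<in> carrier (Bil F U V)"
    note B = this[THEN BilD(2)] this[THEN BilD(3)] this[THEN BilD(4)] this[THEN BilD(5)] this[THEN BilD(6)]
    show "f \<oplus>\<^bsub>Bil F U V\<^esub> g \<in> carrier (Bil F U V)"
      by (rule BilI) (auto simp: Bil_simps B U.R.a_ac U.R.r_distr)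
  next
    fix a f assume "a \<in> carrier F" "f \<in> carrier (Bil F U V)"
    then show "a \<odot>\<^bsub>Bil F U V\<^esub> f \<in> carrier (Bil F U V)"
      by (intro BilI) (auto simp: Bil_simps BilD U.R.m_ac U.R.r_distr)
  next
    show "\<zero>\<^bsub>Bil F U V\<^esub> \<in> carrier (Bil F U V)"
      by (rule BilI) (auto simp: Bil_simps)
  qed (auto simp: Bil_simps fun_eq_iff BilD U.R.a_ac U.R.m_assoc U.R.l_distr U.R.r_distr U.R.is_cring)
qed

text \<open>A zero vector is the scalar \<open>\<zero>\<close> times itself, and the scalar can be
  pulled out of the form.\<close>

lemma (in cring) Bil_eq_zero:
  assumes "module R U" "module R V" "f \<in> carrier (Bil R U V)"
  shows "u \<in> carrier U \<Longrightarrow> f (u, \<zero>\<^bsub>V\<^esub>) = \<zero>" "v \<in> carrier V \<Longrightarrow> f (\<zero>\<^bsub>U\<^esub>, v) = \<zero>"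
proof -
  interpret U: module R U by fact
  interpret V: module R V by fact
  show "u \<in> carrier U \<Longrightarrow> f (u, \<zero>\<^bsub>V\<^esub>) = \<zero>"
    using BilD(5)[OF assms(3), of \<zero> u "\<zero>\<^bsub>V\<^esub>"] BilD(2)[OF assms(3), of u "\<zero>\<^bsub>V\<^esub>"] by simp
  show "v \<in> carrier V \<Longrightarrow> f (\<zero>\<^bsub>U\<^esub>, v) = \<zero>"
    using BilD(6)[OF assms(3), of \<zero> "\<zero>\<^bsub>U\<^esub>" v] BilD(2)[OF assms(3), of "\<zero>\<^bsub>U\<^esub>" v] by simp
qed

subsection \<open>Cocycles and cohomology\<close>

context leibniz_algebra
begin

lemma mult_smult:
  "\<lbrakk>a \<in> carrier F; x \<in> carrier L; y \<in> carrier L\<rbrakk> \<Longrightarrow> (a \<odot>\<^bsub>L\<^esub> x) \<otimes>\<^bsub>L\<^esub> y = a \<odot>\<^bsub>L\<^esub> (x \<otimes>\<^bsub>L\<^esub> y)"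
  "\<lbrakk>a \<in> carrier F; x \<in> carrier L; y \<in> carrier L\<rbrakk> \<Longrightarrow> x \<otimes>\<^bsub>L\<^esub> (a \<odot>\<^bsub>L\<^esub> y) = a \<odot>\<^bsub>L\<^esub> (x \<otimes>\<^bsub>L\<^esub> y)"
  using mult_bilin unfolding bilin_def linear_maps_def by auto

text \<open>The cocycle identity is linear in \<open>f\<close>, so it cuts a submodule out of
  \<open>Bil F L L\<close>.\<close>

lemma cocycles2_module: "module F (cocycles2 F L)"
proof -
  interpret Bil: module F "Bil F L L"
    by (intro Bil_module module_axioms)
  have "submodule (carrier (cocycles2 F L)) F (Bil F L L)"
  proof (rule Bil.submodule_if_closed)
    fix f g assume fg: "f \<in> carrier (cocycles2 F L)" "g \<in> carrier (cocycles2 F L)"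
    note B = fg[THEN cocycles2D(1), THEN BilD(2)]
    show "f \<oplus>\<^bsub>Bil F L L\<^esub> g \<in> carrier (cocycles2 F L)"
      unfolding cocycles2_iff
    proof (intro conjI ballI)
      show "f \<oplus>\<^bsub>Bil F L L\<^esub> g \<in> carrier (Bil F L L)"
        using fg by (intro Bil.M.a_closed cocycles2D(1))
      fix x y z assume xyz: "x \<in> carrier L" "y \<in> carrier L" "z \<in> carrier L"
      show "(f \<oplus>\<^bsub>Bil F L L\<^esub> g) (x, y \<otimes>\<^bsub>L\<^esub> z) =
          (f \<oplus>\<^bsub>Bil F L L\<^esub> g) (x \<otimes>\<^bsub>L\<^esub> y, z) \<oplus> (f \<oplus>\<^bsub>Bil F L L\<^esub> g) (y, x \<otimes>\<^bsub>L\<^esub> z)"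
        using cocycles2D(2)[OF fg(1) xyz] cocycles2D(2)[OF fg(2) xyz] xyz
        by (simp add: Bil_simps mult_closed B R.a_ac)
    qed
  next
    fix a f assume a: "a \<in> carrier F" and f: "f \<in> carrier (cocycles2 F L)"
    note B = BilD(2)[OF cocycles2D(1)[OF f]]
    show "a \<odot>\<^bsub>Bil F L L\<^esub> f \<in> carrier (cocycles2 F L)"
      unfolding cocycles2_iff
    proof (intro conjI ballI)
      show "a \<odot>\<^bsub>Bil F L L\<^esub> f \<in> carrier (Bil F L L)"
        using a f by (intro Bil.smult_closed cocycles2D(1))
      fix x y z assume xyz: "x \<in> carrier L" "y \<in> carrier L" "z \<in> carrier L"
      show "(a \<odot>\<^bsub>Bil F L L\<^esub> f) (x, y \<otimes>\<^bsub>L\<^esub> z) =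
          (a \<odot>\<^bsub>Bil F L L\<^esub> f) (x \<otimes>\<^bsub>L\<^esub> y, z) \<oplus> (a \<odot>\<^bsub>Bil F L L\<^esub> f) (y, x \<otimes>\<^bsub>L\<^esub> z)"
        using cocycles2D(2)[OF f xyz] a xyz by (simp add: Bil_simps mult_closed B R.r_distr)
    qed
  next
    show "\<zero>\<^bsub>Bil F L L\<^esub> \<in> carrier (cocycles2 F L)"
      unfolding cocycles2_iff by (auto simp: Bil_simps(2) mult_closed Bil.M.zero_closed[unfolded Bil_simps(2)])
  qed (auto simp: cocycles2_iff)
  \<comment> \<open>\<open>cocycles2 F L\<close> is \<open>Bil F L L\<close> with its carrier
    replaced, which is the form of module obtained here.\<close>
  from submodule.submodule_is_module[OF this Bil.module_axioms] show ?thesis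
    by (simp add: cocycles2_def)
qed

text \<open>Applying \<open>\<ominus> e\<close> to both sides of the Leibniz identity gives the
  cocycle identity for the coboundary of \<open>e\<close>. Coboundaries depend linearly on
  \<open>e\<close>, which gives the closure properties.\<close>

lemma coboundaries2_submodule: "submodule (coboundaries2 F L) F (cocycles2 F L)"
proof -
  interpret C: module F "cocycles2 F L"
    by (rule cocycles2_module)
  show ?thesis
  proof (rule C.submodule_if_closed)
    show "coboundaries2 F L \<subseteq> carrier (cocycles2 F L)"
    proof
      fix b assume "b \<in> coboundaries2 F L"
      then obtain e where e: "e \<in> linear_maps F L (scalars F)"
          "b = (\<lambda>(x, y)\<in>carrier L \<times> carrier L. \<ominus> e (x \<otimes>\<^bsub>L\<^esub> y))"
        by (elim coboundaries2E)
      note E = linear_mapsD[OF e(1), simplified]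
      have "b \<in> carrier (Bil F L L)"
        by (rule BilI)
          (auto simp: e(2) E mult_closed mult_add_left mult_add_right mult_smult R.minus_add R.r_minus)
      moreover have "b (x, y \<otimes>\<^bsub>L\<^esub> z) = b (x \<otimes>\<^bsub>L\<^esub> y, z) \<oplus> b (y, x \<otimes>\<^bsub>L\<^esub> z)"
        if "x \<in> carrier L" "y \<in> carrier L" "z \<in> carrier L" for x y z
        using leibniz[OF that] that by (simp add: e(2) E mult_closed R.minus_add)
      ultimately show "b \<in> carrier (cocycles2 F L)"
        unfolding cocycles2_iff by blast
    qed
    show "\<zero>\<^bsub>cocycles2 F L\<^esub> \<in> coboundaries2 F L"
    proof (rule coboundaries2I)
      show "(\<lambda>_. \<zero>) \<in> linear_maps F L (scalars F)"
        by (rule linear_mapsI) auto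
    qed (auto simp: Bil_simps fun_eq_iff restrict_def)
    fix a b assume a: "a \<in> carrier F" and "b \<in> coboundaries2 F L"
    then obtain e where e: "e \<in> linear_maps F L (scalars F)"
        "b = (\<lambda>(x, y)\<in>carrier L \<times> carrier L. \<ominus> e (x \<otimes>\<^bsub>L\<^esub> y))"
      by (elim coboundaries2E)
    note E = linear_mapsD[OF e(1), simplified]
    show "a \<odot>\<^bsub>cocycles2 F L\<^esub> b \<in> coboundaries2 F L"
    proof (rule coboundaries2I)
      show "(\<lambda>x. a \<otimes> e x) \<in> linear_maps F L (scalars F)"
        by (rule linear_mapsI) (simp_all add: a E R.r_distr R.m_lcomm)
      show "a \<odot>\<^bsub>cocycles2 F L\<^esub> b =
          (\<lambda>(x, y)\<in>carrier L \<times> carrier L. \<ominus> (a \<otimes> e (x \<otimes>\<^bsub>L\<^esub> y)))"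
        by (auto simp: a e(2) E Bil_simps fun_eq_iff restrict_def mult_closed R.r_minus)
    qed
  qed (auto simp: coboundaries2_add)
qed

lemma cohomology2_module: "module F (cohomology2 F L)"
  unfolding cohomology2_def
  by (intro module.quot_module_module cocycles2_module coboundaries2_submodule)

text \<open>Coset arithmetic rephrased for \<open>cohomology_class\<close>, so that linearity of Inf
  and \<delta> can be checked on representing cocycles.\<close>

lemma cohomology2_simps:
  "carrier (cohomology2 F L) = cohomology_class F L ` carrier (cocycles2 F L)"
  "\<lbrakk>f \<in> carrier (cocycles2 F L); g \<in> carrier (cocycles2 F L)\<rbrakk> \<Longrightarrow>
    cohomology_class F L f \<oplus>\<^bsub>cohomology2 F L\<^esub> cohomology_class F L g =
    cohomology_class F L (f \<oplus>\<^bsub>cocycles2 F L\<^esub> g)"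
  "\<lbrakk>a \<in> carrier F; f \<in> carrier (cocycles2 F L)\<rbrakk> \<Longrightarrow>
    a \<odot>\<^bsub>cohomology2 F L\<^esub> cohomology_class F L f = cohomology_class F L (a \<odot>\<^bsub>cocycles2 F L\<^esub> f)"
  unfolding cohomology2_def cohomology_class_def
  by (rule carrier_quot_module module.coset_add[OF cocycles2_module coboundaries2_submodule]
      module.coset_smult[OF cocycles2_module coboundaries2_submodule]; assumption)+

section \<open>The abelianization \<open>L/L'\<close>\<close>

lemma derived_submodule: "submodule (leibniz_derived F L) F L"
  unfolding leibniz_derived_def by (rule submodule_hull) (auto simp: mult_closed)

abbreviation "A \<equiv> quot_module L (leibniz_derived F L)"

lemma abelianization_module: "module F A"
  by (rule quot_module_module[OF derived_submodule])

lemmas abelianization_simps =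
  carrier_quot_module coset_add[OF derived_submodule] coset_smult[OF derived_submodule]

subsection \<open>The maps Inf and \<open>\<delta>\<close>\<close>

context
  fixes Z
  assumes Z: "central_ideal Z F L"
begin

section \<open>The quotient algebra \<open>L/Z\<close>\<close>

abbreviation "Q \<equiv> quot_module L Z"

lemmas quotient_simps = carrier_quot_module quotient_add[OF Z] quotient_smult[OF Z] quotient_mult[OF Z]

text \<open>Makes the results on cocycles and cohomology of \<open>L\<close> available for
  \<open>Q\<close>. All operations on cosets are computed on representatives, so the identities
  descend from \<open>L\<close>.\<close>

lemma quotient_leibniz: "leibniz_algebra F Q"
proof (intro leibniz_algebra.intro leibniz_algebra_axioms.intro)
  show "module F Q"
    by (rule quot_module_module[OF Z_submodule[OF Z]])
  show "field F" ..
  show "bilin F Q Q Q (\<otimes>\<^bsub>Q\<^esub>)"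
    unfolding bilin_def
    by (auto intro!: linear_mapsI simp: quotient_simps mult_closed mult_add_left mult_add_right mult_smult)
  fix X Y W assume "X \<in> carrier Q" "Y \<in> carrier Q" "W \<in> carrier Q"
  then obtain x y w where "x \<in> carrier L" "y \<in> carrier L" "w \<in> carrier L"
      "X = Z +>\<^bsub>L\<^esub> x" "Y = Z +>\<^bsub>L\<^esub> y" "W = Z +>\<^bsub>L\<^esub> w"
    by (auto simp: carrier_quot_module)
  then show "X \<otimes>\<^bsub>Q\<^esub> (Y \<otimes>\<^bsub>Q\<^esub> W) = (X \<otimes>\<^bsub>Q\<^esub> Y) \<otimes>\<^bsub>Q\<^esub> W \<oplus>\<^bsub>Q\<^esub> Y \<otimes>\<^bsub>Q\<^esub> (X \<otimes>\<^bsub>Q\<^esub> W)"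
    using leibniz[of x y w] by (simp add: quotient_simps mult_closed)
qed

section \<open>Inflation of cocycles and linearity of Inf\<close>

lemma inflate_apply:
  "\<lbrakk>x \<in> carrier L; y \<in> carrier L\<rbrakk> \<Longrightarrow> inflate L Z f (x, y) = f (Z +>\<^bsub>L\<^esub> x, Z +>\<^bsub>L\<^esub> y)"
  by (simp add: inflate_def)

lemma coset_in_quotient: "x \<in> carrier L \<Longrightarrow> Z +>\<^bsub>L\<^esub> x \<in> carrier Q"
  by (auto simp: carrier_quot_module)

text \<open>Inflation is the pullback along the projection of \<open>L\<close> onto
  \<open>Q\<close>; this projection is linear and multiplicative, so bilinearity and the cocycle
  identity are preserved.\<close>

lemma inflate_cocycle:
  assumes f: "f \<in> carrier (cocycles2 F Q)"
  shows "inflate L Z f \<in> carrier (cocycles2 F L)"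
proof -
  note B = BilD[OF cocycles2D(1)[OF f]] and C = cocycles2D(2)[OF f]
  have "inflate L Z f \<in> carrier (Bil F L L)"
    \<comment> \<open>Used from right to left, the quotient rules turn the coset of a sum or
      multiple into a sum or multiple of cosets, where the bilinearity of \<open>f\<close> applies.
      The final \<open>simp\<close> shows that the inflated form is extensional.\<close>
    by (rule BilI)
      (auto simp: inflate_apply B coset_in_quotient
        simp flip: quotient_add[OF Z] quotient_smult[OF Z], simp add: inflate_def)
  moreover have "inflate L Z f (x, y \<otimes>\<^bsub>L\<^esub> z) =
      inflate L Z f (x \<otimes>\<^bsub>L\<^esub> y, z) \<oplus> inflate L Z f (y, x \<otimes>\<^bsub>L\<^esub> z)"
    if "x \<in> carrier L" "y \<in> carrier L" "z \<in> carrier L" for x y z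
    using that C[OF that[THEN coset_in_quotient]]
    by (simp add: inflate_apply mult_closed quotient_mult[OF Z])
  ultimately show ?thesis
    unfolding cocycles2_iff by blast
qed

lemma inflate_add:
  "inflate L Z (f \<oplus>\<^bsub>cocycles2 F Q\<^esub> g) = inflate L Z f \<oplus>\<^bsub>cocycles2 F L\<^esub> inflate L Z g"
  and inflate_smult: "inflate L Z (a \<odot>\<^bsub>cocycles2 F Q\<^esub> f) = a \<odot>\<^bsub>cocycles2 F L\<^esub> inflate L Z f"
  by (auto simp: inflate_def Bil_simps coset_in_quotient fun_eq_iff restrict_def)

lemma inflation_linear: "inflation F L Z \<in> linear_maps F (cohomology2 F Q) (cohomology2 F L)"
proof -
  interpret Q: leibniz_algebra F Q
    by (rule quotient_leibniz)
  interpret CQ: module F "cocycles2 F Q"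
    by (rule Q.cocycles2_module)
  show ?thesis
    \<comment> \<open>With \<open>cocycles2_simps\<close> removed, the operations remain those of
      the cocycle modules, as \<open>cohomology2_simps\<close> and \<open>inflate_add\<close>
      expect.\<close>
    by (rule linear_mapsI)
      (auto simp: cohomology2_simps Q.cohomology2_simps inflation_class[OF Z] inflate_cocycle
        inflate_add inflate_smult CQ.M.a_closed CQ.smult_closed simp del: cocycles2_simps)
qed

section \<open>Values and linearity of \<delta>\<close>

abbreviation "K \<equiv> L\<lparr>carrier := Z\<rparr>"

lemma central_module: "module F K"
  by (rule submodule.submodule_is_module[OF Z_submodule[OF Z] module_axioms])

text \<open>By \<open>delta_apply\<close> the values can be computed at any representative of a
  coset of \<open>L'\<close>, so bilinearity is inherited from \<open>f\<close>.\<close>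

lemma delta12_Bil:
  assumes f: "f \<in> carrier (cocycles2 F L)"
  shows "delta1 F L Z f \<in> carrier (Bil F A K)" "delta2 F L Z f \<in> carrier (Bil F K A)"
proof -
  note B = BilD[OF cocycles2D(1)[OF f]] and ap = delta_apply[OF Z f]
  have ZL: "\<And>z. z \<in> Z \<Longrightarrow> z \<in> carrier L"
    using Z_carrier[OF Z] .
  have Zc: "\<And>z w. \<lbrakk>z \<in> Z; w \<in> Z\<rbrakk> \<Longrightarrow> z \<oplus>\<^bsub>L\<^esub> w \<in> Z" "\<And>a z. \<lbrakk>a \<in> carrier F; z \<in> Z\<rbrakk> \<Longrightarrow> a \<odot>\<^bsub>L\<^esub> z \<in> Z"
    using submoduleE(4,5)[OF Z_submodule[OF Z]] by auto
  show "delta1 F L Z f \<in> carrier (Bil F A K)"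
    by (rule BilI) (auto simp: abelianization_simps ap B ZL Zc, simp add: delta1_def carrier_quot_module)
  show "delta2 F L Z f \<in> carrier (Bil F K A)"
    by (rule BilI) (auto simp: abelianization_simps ap B ZL Zc, simp add: delta2_def carrier_quot_module)
qed

text \<open>Every element of \<open>A\<close> is the coset of some \<open>x\<close>, and forms are
  extensional, so the values listed here determine both components. Additivity, homogeneity and
  vanishing of \<delta> thereby become pointwise statements about \<open>f\<close>.\<close>

lemma delta12_eqI:
  assumes "f \<in> carrier (cocycles2 F L)"
    and "g1 \<in> carrier (Bil F A K)" "g2 \<in> carrier (Bil F K A)"
    and "\<And>x z. \<lbrakk>x \<in> carrier L; z \<in> Z\<rbrakk> \<Longrightarrow> g1 (leibniz_derived F L +>\<^bsub>L\<^esub> x, z) = f (x, z)"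
    and "\<And>x z. \<lbrakk>x \<in> carrier L; z \<in> Z\<rbrakk> \<Longrightarrow> g2 (z, leibniz_derived F L +>\<^bsub>L\<^esub> x) = f (z, x)"
  shows "delta1 F L Z f = g1" "delta2 F L Z f = g2"
proof -
  show "delta1 F L Z f = g1"
    by (rule extensionalityI[OF BilD(1)[OF delta12_Bil(1)[OF assms(1)]] BilD(1)[OF assms(2)]])
      (auto simp: carrier_quot_module delta_apply[OF Z assms(1)] assms(4,5))
  show "delta2 F L Z f = g2"
    by (rule extensionalityI[OF BilD(1)[OF delta12_Bil(2)[OF assms(1)]] BilD(1)[OF assms(3)]])
      (auto simp: carrier_quot_module delta_apply[OF Z assms(1)] assms(4,5))
qed

lemma delta12_add:
  assumes f: "f \<in> carrier (cocycles2 F L)" and g: "g \<in> carrier (cocycles2 F L)"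
  shows "delta1 F L Z (f \<oplus>\<^bsub>cocycles2 F L\<^esub> g) = delta1 F L Z f \<oplus>\<^bsub>Bil F A K\<^esub> delta1 F L Z g"
    and "delta2 F L Z (f \<oplus>\<^bsub>cocycles2 F L\<^esub> g) = delta2 F L Z f \<oplus>\<^bsub>Bil F K A\<^esub> delta2 F L Z g"
proof -
  interpret C: module F "cocycles2 F L"
    by (rule cocycles2_module)
  interpret B1: module F "Bil F A K"
    by (intro Bil_module abelianization_module central_module)
  interpret B2: module F "Bil F K A"
    by (intro Bil_module abelianization_module central_module)
  note fg = C.M.a_closed[OF f g]
    B1.M.a_closed[OF delta12_Bil(1)[OF f] delta12_Bil(1)[OF g]]
    B2.M.a_closed[OF delta12_Bil(2)[OF f] delta12_Bil(2)[OF g]]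
  show "delta1 F L Z (f \<oplus>\<^bsub>cocycles2 F L\<^esub> g) = delta1 F L Z f \<oplus>\<^bsub>Bil F A K\<^esub> delta1 F L Z g"
    "delta2 F L Z (f \<oplus>\<^bsub>cocycles2 F L\<^esub> g) = delta2 F L Z f \<oplus>\<^bsub>Bil F K A\<^esub> delta2 F L Z g"
    by (rule delta12_eqI[OF fg];
        simp add: Bil_simps carrier_quot_module delta_apply[OF Z f] delta_apply[OF Z g] Z_carrier[OF Z])+
qed

lemma delta12_smult:
  assumes a: "a \<in> carrier F" and f: "f \<in> carrier (cocycles2 F L)"
  shows "delta1 F L Z (a \<odot>\<^bsub>cocycles2 F L\<^esub> f) = a \<odot>\<^bsub>Bil F A K\<^esub> delta1 F L Z f"
    and "delta2 F L Z (a \<odot>\<^bsub>cocycles2 F L\<^esub> f) = a \<odot>\<^bsub>Bil F K A\<^esub> delta2 F L Z f"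
proof -
  interpret C: module F "cocycles2 F L"
    by (rule cocycles2_module)
  interpret B1: module F "Bil F A K"
    by (intro Bil_module abelianization_module central_module)
  interpret B2: module F "Bil F K A"
    by (intro Bil_module abelianization_module central_module)
  note af = C.smult_closed[OF a f]
    B1.smult_closed[OF a delta12_Bil(1)[OF f]] B2.smult_closed[OF a delta12_Bil(2)[OF f]]
  show "delta1 F L Z (a \<odot>\<^bsub>cocycles2 F L\<^esub> f) = a \<odot>\<^bsub>Bil F A K\<^esub> delta1 F L Z f"
    "delta2 F L Z (a \<odot>\<^bsub>cocycles2 F L\<^esub> f) = a \<odot>\<^bsub>Bil F K A\<^esub> delta2 F L Z f"
    by (rule delta12_eqI[OF af];
        simp add: Bil_simps carrier_quot_module delta_apply[OF Z f] Z_carrier[OF Z])+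
qed

lemma delta_linear:
  "delta F L Z \<in> linear_maps F (cohomology2 F L) (direct_sum (Bil F A K) (Bil F K A))"
proof -
  interpret C: module F "cocycles2 F L"
    by (rule cocycles2_module)
  show ?thesis
    by (rule linear_mapsI)
      (auto simp: cohomology2_simps direct_sum_simps delta_class[OF Z] delta12_Bil
        delta12_add delta12_smult C.M.a_closed C.smult_closed simp del: cocycles2_simps)
qed

section \<open>Exactness at the cohomology of \<open>L\<close>\<close>

lemma delta12_eq_zero_iff:
  assumes f: "f \<in> carrier (cocycles2 F L)"
  shows "delta1 F L Z f = \<zero>\<^bsub>Bil F A K\<^esub> \<and> delta2 F L Z f = \<zero>\<^bsub>Bil F K A\<^esub> \<longleftrightarrow>
    (\<forall>x\<in>carrier L. \<forall>z\<in>Z. f (x, z) = \<zero> \<and> f (z, x) = \<zero>)" (is "?l \<longleftrightarrow> ?r")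
proof
  assume l: ?l
  show ?r
  proof (intro ballI)
    fix x z assume "x \<in> carrier L" "z \<in> Z"
    then show "f (x, z) = \<zero> \<and> f (z, x) = \<zero>"
      using l by (simp add: Bil_simps carrier_quot_module flip: delta_apply[OF Z f])
  qed
next
  interpret B1: module F "Bil F A K"
    by (intro Bil_module abelianization_module central_module)
  interpret B2: module F "Bil F K A"
    by (intro Bil_module abelianization_module central_module)
  assume ?r
  then show ?l
    \<comment> \<open>The zero forms serve as the candidates \<open>g1\<close> and
      \<open>g2\<close>.\<close>
    by (intro conjI delta12_eqI[OF f B1.M.zero_closed B2.M.zero_closed])
      (simp_all add: Bil_simps carrier_quot_module)
qed

lemma cocycle_eq_inflate:
  assumes f: "f \<in> carrier (cocycles2 F L)"
    and 0: "\<And>x z. \<lbrakk>x \<in> carrier L; z \<in> Z\<rbrakk> \<Longrightarrow> f (x, z) = \<zero> \<and> f (z, x) = \<zero>"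
  obtains g where "g \<in> carrier (cocycles2 F Q)" "f = inflate L Z g"
proof -
  \<comment> \<open>The form on \<open>Q\<close> evaluates \<open>f\<close> at arbitrarily chosen
    representatives of the two cosets.\<close>
  define g where "g = (\<lambda>(X, Y)\<in>carrier Q \<times> carrier Q. f (SOME x. x \<in> X, SOME y. y \<in> Y))"
  note B = BilD[OF cocycles2D(1)[OF f]] and C = cocycles2D(2)[OF f]
  \<comment> \<open>A coset contains its own representative, so the choice lands in it and differs
    from \<open>x\<close> by an element of \<open>Z\<close>.\<close>
  have rep: "\<exists>n\<in>Z. (SOME y. y \<in> Z +>\<^bsub>L\<^esub> x) = n \<oplus>\<^bsub>L\<^esub> x" if "x \<in> carrier L" for x
    using someI[of "\<lambda>y. y \<in> Z +>\<^bsub>L\<^esub> x", OF mem_own_coset[OF Z that]] unfolding mem_a_r_coset .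
  have g: "g (Z +>\<^bsub>L\<^esub> x, Z +>\<^bsub>L\<^esub> y) = f (x, y)" if "x \<in> carrier L" "y \<in> carrier L" for x y
  proof -
    obtain n m where "n \<in> Z" "m \<in> Z" "(SOME u. u \<in> Z +>\<^bsub>L\<^esub> x) = n \<oplus>\<^bsub>L\<^esub> x"
        "(SOME u. u \<in> Z +>\<^bsub>L\<^esub> y) = m \<oplus>\<^bsub>L\<^esub> y"
      using rep[OF \<open>x \<in> carrier L\<close>] rep[OF \<open>y \<in> carrier L\<close>] by blast
    \<comment> \<open>Expanding \<open>f\<close> at \<open>n + x\<close> and \<open>m + y\<close>
      gives four terms; the three involving \<open>n\<close> or \<open>m\<close> vanish by
      \<open>0\<close>, leaving \<open>f (x, y)\<close>.\<close>
    then show ?thesis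
      using that by (simp add: g_def coset_in_quotient B 0 Z_carrier[OF Z])
  qed
  have "g \<in> carrier (Bil F Q Q)"
    by (rule BilI) (auto simp: quotient_simps g B, simp add: g_def carrier_quot_module)
  moreover have "g (X, Y \<otimes>\<^bsub>Q\<^esub> W) = g (X \<otimes>\<^bsub>Q\<^esub> Y, W) \<oplus> g (Y, X \<otimes>\<^bsub>Q\<^esub> W)"
    if "X \<in> carrier Q" "Y \<in> carrier Q" "W \<in> carrier Q" for X Y W
    using that by (auto simp: quotient_simps g mult_closed intro: C)
  ultimately have "g \<in> carrier (cocycles2 F Q)"
    unfolding cocycles2_iff by blast
  moreover have "f = inflate L Z g"
    by (rule extensionalityI[OF B(1)]) (auto simp: inflate_def g)
  ultimately show thesis
    by (rule that)
qed

text \<open>Both sides equal the set of classes of those cocycles on \<open>L\<close> that vanish as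
  soon as one argument lies in \<open>Z\<close>.\<close>

lemma inflation_delta_exact:
  "inflation F L Z ` carrier (cohomology2 F Q) =
    a_kernel (cohomology2 F L) (direct_sum (Bil F A K) (Bil F K A)) (delta F L Z)"
proof -
  interpret Q: leibniz_algebra F Q
    by (rule quotient_leibniz)
  have ZQ: "Z +>\<^bsub>L\<^esub> z = \<zero>\<^bsub>Q\<^esub>" if "z \<in> Z" for z
    using that by (rule coset_eq_zero[OF Z_submodule[OF Z]])
  have iff: "delta F L Z (cohomology_class F L f) = \<zero>\<^bsub>direct_sum (Bil F A K) (Bil F K A)\<^esub> \<longleftrightarrow>
      (\<forall>x\<in>carrier L. \<forall>z\<in>Z. f (x, z) = \<zero> \<and> f (z, x) = \<zero>)" if "f \<in> carrier (cocycles2 F L)" for f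
    using delta12_eq_zero_iff[OF that] by (simp add: delta_class[OF Z that] direct_sum_simps)
  \<comment> \<open>An element of \<open>Z\<close> becomes zero in \<open>Q\<close>, where every
    bilinear form kills it. This is the half saying that \<delta> after Inf is zero.\<close>
  have vanish: "inflate L Z g (x, z) = \<zero> \<and> inflate L Z g (z, x) = \<zero>"
    if "g \<in> carrier (cocycles2 F Q)" "x \<in> carrier L" "z \<in> Z" for g x z
    using that R.Bil_eq_zero[OF Q.module_axioms Q.module_axioms cocycles2D(1)[OF that(1)]]
    by (simp add: inflate_apply Z_carrier[OF Z] ZQ coset_in_quotient)
  have "inflation F L Z ` carrier (cohomology2 F Q) =
      (\<lambda>g. cohomology_class F L (inflate L Z g)) ` carrier (cocycles2 F Q)"
    unfolding Q.cohomology2_simps image_image by (intro image_cong refl inflation_class[OF Z])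
  also have "\<dots> = cohomology_class F L `
      {f \<in> carrier (cocycles2 F L). \<forall>x\<in>carrier L. \<forall>z\<in>Z. f (x, z) = \<zero> \<and> f (z, x) = \<zero>}"
    \<comment> \<open>Inflated cocycles vanish on \<open>Z\<close>; conversely
      \<open>cocycle_eq_inflate\<close> descends a vanishing cocycle to \<open>Q\<close>, so the two
      sets agree already before passing to classes.\<close>
    using inflate_cocycle vanish by (fastforce elim: cocycle_eq_inflate)
  also have "\<dots> = a_kernel (cohomology2 F L) (direct_sum (Bil F A K) (Bil F K A)) (delta F L Z)"
    unfolding a_kernel_def' cohomology2_simps using iff by blast
  finally show ?thesis .
qed

end

end

theorem theorem4p1:
  fixes F :: "('a, 'r) ring_scheme" and L :: "('a, 'b, 'm) module_scheme" and Z :: "'b set"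
  assumes "leibniz_algebra F L"
    and "central_ideal Z F L"
  shows "exact_at F
    (cohomology2 F (quot_module L Z))
    (inflation F L Z)
    (cohomology2 F L)
    (delta F L Z)
    (direct_sum
      (Bil F (quot_module L (leibniz_derived F L)) (L\<lparr>carrier := Z\<rparr>))
      (Bil F (L\<lparr>carrier := Z\<rparr>) (quot_module L (leibniz_derived F L))))"
proof -
  interpret leibniz_algebra F L by fact
  note Z = \<open>central_ideal Z F L\<close>
  show ?thesis
    unfolding exact_at_def
    \<comment> \<open>The first term is a module because \<open>L/Z\<close> is itself a Leibniz
      algebra.\<close>
    by (intro conjI leibniz_algebra.cohomology2_module[OF quotient_leibniz[OF Z]] cohomology2_module
        direct_sum_module Bil_module abelianization_module central_module[OF Z]
        inflation_linear[OF Z] delta_linear[OF Z] inflation_delta_exact[OF Z])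
qed

end
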